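(* Let $\mathsf V$ be a pseudovariety of semigroups containing $\mathsf N$, and let $\xi\colon\overline{\Omega}_B\mathsf V\to\overline{\Omega}_{A_0}\mathsf V$ be a $\mathsf V$-compression of a bounded directive sequence $\boldsymbol{\sigma}=(\sigma_n)_{n\in\mathbb N}$, $\sigma_n\colon A_{n+1}^+\to A_n^+$. Then the equality $\mathrm{Im}(\xi)=\mathrm{Im}_{\mathsf V}(\boldsymbol{\sigma})$ holds. Moreover, the inclusion $\xi(B)\subseteq\Lambda_{\mathsf V}(\boldsymbol{\sigma})$ holds.
   Context: A directive sequence is a sequence $\boldsymbol{\sigma}=(\sigma_n)_{n\in\mathbb N}$ of homomorphisms $\sigma_n\colon A_{n+1}^+\to A_n^+$ between free semigroups on finite nonempty alphabets; it is bounded if the set $\{A_n:n\in\mathbb N\}$ of its alphabets is finite. Put $\sigma_{n,m}=\sigma_n\circ\cdots\circ\sigma_{m-1}$ for $n\le m$ (identity if $n=m$). A pseudovariety of semigroups is a class of finite semigroups closed under subsemigroups, homomorphic images and finite direct products. $\mathsf N$ is the pseudovariety of finite nilpotent semigroups (those with a zero $0$ and $S^k=\{0\}$ for some $k\ge1$). $\overline{\Omega}_A\mathsf V$ is the free pro-$\mathsf V$ semigroup on $A$ (pro-$\mathsf V$: inverse limit of members of $\mathsf V$ with discrete topologies); as $\mathsf V\supseteq\mathsf N$ it contains $A^+$ as a dense subsemigroup, and each homomorphism $\varphi\colon A^+\to B^+$ extends uniquely to a continuous homomorphism $\varphi^{\mathsf V}\colon\overline{\Omega}_A\mathsf V\to\overline{\Omega}_B\mathsf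 V$. The $\mathsf V$-image is $\mathrm{Im}_{\mathsf V}(\boldsymbol{\sigma})=\bigcap_{n\in\mathbb N}\mathrm{Im}(\sigma_{0,n}^{\mathsf V})$. $\Lambda_{\mathsf V}(\boldsymbol{\sigma})$ is the set of elements of $\overline{\Omega}_{A_0}\mathsf V$ that are cluster points of some sequence $(w_n)_{n\in\mathbb N}$ with $w_n\in\sigma_{0,n}(A_n)$ for every $n$. A $\mathsf V$-compression of a bounded $\boldsymbol{\sigma}$ is a cluster point of the sequence $(\sigma_{0,n}^{\mathsf V})_{n\in\mathbb N}$ in the space of all continuous homomorphisms between members of the finite set $\{\overline{\Omega}_{A_n}\mathsf V:n\in\mathbb N\}$, this space being the disjoint union (coproduct) of the sets $\mathrm{Hom}(\overline{\Omega}_{A_k}\mathsf V,\overline{\Omega}_{A_l}\mathsf V)$ of continuous homomorphisms, each with the topology of pointwise convergence. Thus a $\mathsf V$-compression is a continuous homomorphism $\xi\colon\overline{\Omega}_B\mathsf V\to\overline{\Omega}_{A_0}\mathsf V$ where $B=A_n$ for infinitely many $n$ and $\xi$ is a pointwise cluster point of the $\sigma_{0,n}^{\mathsf V}$ with $A_n=B$. *)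

theory Defs
  imports "HOL-Analysis.Analysis" "HOL-Library.FuncSet"
begin

section \<open>Semigroups and pseudovarieties\<close>

record 'a sgrp =
  scarrier :: "'a set"
  smult :: "'a \<Rightarrow> 'a \<Rightarrow> 'a"

definition is_semigroup :: "'a sgrp \<Rightarrow> bool" where
  "is_semigroup S \<longleftrightarrow> scarrier S \<noteq> {} \<and>
     (\<forall>x\<in>scarrier S. \<forall>y\<in>scarrier S. smult S x y \<in> scarrier S) \<and>
     (\<forall>x\<in>scarrier S. \<forall>y\<in>scarrier S. \<forall>z\<in>scarrier S.
        smult S (smult S x y) z = smult S x (smult S y z))"

definition sgrp_hom :: "'a sgrp \<Rightarrow> 'b sgrp \<Rightarrow> ('a \<Rightarrow> 'b) set" where
  "sgrp_hom S T = {h \<in> scarrier S \<rightarrow> scarrier T.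
     \<forall>x\<in>scarrier S. \<forall>y\<in>scarrier S. h (smult S x y) = smult T (h x) (h y)}"

definition subsemigroup :: "'a sgrp \<Rightarrow> 'a sgrp \<Rightarrow> bool" where
  "subsemigroup T S \<longleftrightarrow> is_semigroup T \<and> scarrier T \<subseteq> scarrier S \<and>
     (\<forall>x\<in>scarrier T. \<forall>y\<in>scarrier T. smult T x y = smult S x y)"

definition sgrp_prod :: "'i set \<Rightarrow> ('i \<Rightarrow> 'a sgrp) \<Rightarrow> ('i \<Rightarrow> 'a) sgrp" where
  "sgrp_prod I S = \<lparr>scarrier = (\<Pi>\<^sub>E i\<in>I. scarrier (S i)),
                    smult = (\<lambda>x y. \<lambda>i\<in>I. smult (S i) (x i) (y i))\<rparr>"

definition sgrp_iso :: "'a sgrp \<Rightarrow> 'b sgrp \<Rightarrow> bool" where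
  "sgrp_iso S T \<longleftrightarrow> (\<exists>h\<in>sgrp_hom S T. bij_betw h (scarrier S) (scarrier T))"

text \<open>Every finite semigroup is isomorphic to one whose elements are natural numbers, and a
  pseudovariety is closed under isomorphism; so a class of finite semigroups is represented by
  the set of its members carried by finite sets of natural numbers.  The empty product
  (\<open>I = {}\<close>) is the trivial semigroup.\<close>

definition pseudovariety :: "nat sgrp set \<Rightarrow> bool" where
  "pseudovariety V \<longleftrightarrow>
     (\<forall>S\<in>V. is_semigroup S \<and> finite (scarrier S)) \<and>
     (\<forall>S\<in>V. \<forall>T. subsemigroup T S \<longrightarrow> T \<in> V) \<and>
     (\<forall>S\<in>V. \<forall>T h. is_semigroup T \<and> h \<in> sgrp_hom S T \<and> h ` scarrier S = scarrier T \<longrightarrow> T \<in> V) \<and>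
     (\<forall>(I :: nat set) S T. finite I \<and> (\<forall>i\<in>I. S i \<in> V) \<and> is_semigroup T \<and>
        sgrp_iso (sgrp_prod I S) T \<longrightarrow> T \<in> V)"

text \<open>\<open>sgrp_pow S k\<close> is the power of \<open>S\<close> with exponent \<open>k + 1\<close>.\<close>

primrec sgrp_pow :: "'a sgrp \<Rightarrow> nat \<Rightarrow> 'a set" where
  "sgrp_pow S 0 = scarrier S"
| "sgrp_pow S (Suc k) = {smult S x y | x y. x \<in> sgrp_pow S k \<and> y \<in> scarrier S}"

definition nilpotent_sgrp :: "'a sgrp \<Rightarrow> bool" where
  "nilpotent_sgrp S \<longleftrightarrow>
     (\<exists>z\<in>scarrier S. (\<forall>x\<in>scarrier S. smult S z x = z \<and> smult S x z = z) \<and>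
        (\<exists>k. sgrp_pow S k = {z}))"

definition pv_N :: "nat sgrp set" where
  "pv_N = {S. is_semigroup S \<and> finite (scarrier S) \<and> nilpotent_sgrp S}"


section \<open>Free semigroups\<close>

definition words :: "'a set \<Rightarrow> 'a list set" where
  "words A = {w. w \<noteq> [] \<and> set w \<subseteq> A}"

definition word_hom :: "'a set \<Rightarrow> 'b set \<Rightarrow> ('a list \<Rightarrow> 'b list) \<Rightarrow> bool" where
  "word_hom A B \<phi> \<longleftrightarrow> \<phi> \<in> words A \<rightarrow> words B \<and>
     (\<forall>u\<in>words A. \<forall>v\<in>words A. \<phi> (u @ v) = \<phi> u @ \<phi> v)"

text \<open>\<open>sgrp_eval S f w\<close> is the value at the nonempty word \<open>w\<close> of the homomorphism into \<open>S\<close>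
  extending \<open>f\<close>.\<close>

fun sgrp_eval :: "'b sgrp \<Rightarrow> ('a \<Rightarrow> 'b) \<Rightarrow> 'a list \<Rightarrow> 'b" where
  "sgrp_eval S f [a] = f a"
| "sgrp_eval S f (a # b # w) = smult S (f a) (sgrp_eval S f (b # w))"


section \<open>Free pro-V semigroups\<close>

text \<open>The free pro-\<open>V\<close> semigroup over \<open>A\<close> is realised as the inverse limit of all
  \<open>A\<close>-generated members of \<open>V\<close>, the connecting maps being the homomorphisms
  that respect the generators.\<close>

definition generated_members :: "nat sgrp set \<Rightarrow> 'a set \<Rightarrow> (nat sgrp \<times> ('a \<Rightarrow> nat)) set" where
  "generated_members V A =
     {(S, f). S \<in> V \<and> f \<in> A \<rightarrow>\<^sub>E scarrier S \<and> sgrp_eval S f ` words A = scarrier S}"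

type_synonym 'a proelt = "nat sgrp \<times> ('a \<Rightarrow> nat) \<Rightarrow> nat"

definition free_pro :: "nat sgrp set \<Rightarrow> 'a set \<Rightarrow> 'a proelt topology" where
  "free_pro V A =
     subtopology
       (product_topology (\<lambda>(S, f). discrete_topology (scarrier S)) (generated_members V A))
       {x. \<forall>(S, f)\<in>generated_members V A. \<forall>(T, g)\<in>generated_members V A.
             \<forall>h\<in>sgrp_hom S T. (\<forall>a\<in>A. h (f a) = g a) \<longrightarrow> h (x (S, f)) = x (T, g)}"

definition free_pro_sgrp :: "nat sgrp set \<Rightarrow> 'a set \<Rightarrow> 'a proelt sgrp" where
  "free_pro_sgrp V A =
     \<lparr>scarrier = topspace (free_pro V A),
      smult = (\<lambda>x y. \<lambda>(S, f)\<in>generated_members V A. smult S (x (S, f)) (y (S, f)))\<rparr>"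

text \<open>The canonical homomorphism from the free semigroup to the free pro-\<open>V\<close> semigroup
  (injective when \<open>pv_N \<subseteq> V\<close> and \<open>A\<close> is finite; its image is dense).\<close>

definition free_emb :: "nat sgrp set \<Rightarrow> 'a set \<Rightarrow> 'a list \<Rightarrow> 'a proelt" where
  "free_emb V A w = (\<lambda>(S, f)\<in>generated_members V A. sgrp_eval S f w)"

definition cont_homs ::
    "nat sgrp set \<Rightarrow> 'a set \<Rightarrow> 'b set \<Rightarrow> ('a proelt \<Rightarrow> 'b proelt) set" where
  "cont_homs V A B =
     {\<psi> \<in> sgrp_hom (free_pro_sgrp V A) (free_pro_sgrp V B).
        \<psi> \<in> extensional (topspace (free_pro V A)) \<and>
        continuous_map (free_pro V A) (free_pro V B) \<psi>}"

text \<open>The unique continuous extension of a homomorphism of free semigroups; see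
  \<open>pro_ext_unique_existence\<close> below.\<close>

definition pro_ext ::
    "nat sgrp set \<Rightarrow> 'a set \<Rightarrow> 'b set \<Rightarrow> ('a list \<Rightarrow> 'b list) \<Rightarrow> 'a proelt \<Rightarrow> 'b proelt" where
  "pro_ext V A B \<phi> =
     (THE \<psi>. \<psi> \<in> cont_homs V A B \<and>
        (\<forall>w\<in>words A. \<psi> (free_emb V A w) = free_emb V B (\<phi> w)))"

lemma words_induct [consumes 1, case_names single cons]:
  assumes "w \<in> words A" "\<And>a. a \<in> A \<Longrightarrow> P [a]"
    "\<And>a w. \<lbrakk>a \<in> A; w \<in> words A; P w\<rbrakk> \<Longrightarrow> P (a # w)"
  shows "P w"
  using assms(1)
proof (induction w)
  case (Cons a w)
  then show ?case using assms(2,3) by (cases w) (auto simp: words_def)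
qed (simp add: words_def)

lemma sgrp_eval_Cons: "w \<in> words A \<Longrightarrow> sgrp_eval S f (a # w) = smult S (f a) (sgrp_eval S f w)"
  by (cases w) (auto simp: words_def)

lemma sgrp_eval_closed:
  assumes "w \<in> words A" "is_semigroup S" "f \<in> A \<rightarrow> scarrier S"
  shows "sgrp_eval S f w \<in> scarrier S"
  using assms by (induction rule: words_induct) (auto simp: sgrp_eval_Cons is_semigroup_def)

lemma sgrp_eval_append:
  assumes "u \<in> words A" "v \<in> words A" "is_semigroup S" "f \<in> A \<rightarrow> scarrier S"
  shows "sgrp_eval S f (u @ v) = smult S (sgrp_eval S f u) (sgrp_eval S f v)"
  using assms
proof (induction rule: words_induct)
  case (cons a w)
  have "w @ v \<in> words A" using cons by (auto simp: words_def)
  moreover have "sgrp_eval S f w \<in> scarrier S" "sgrp_eval S f v \<in> scarrier S" "f a \<in> scarrier S"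
    using cons by (auto intro: sgrp_eval_closed)
  ultimately show ?case using cons by (simp add: sgrp_eval_Cons is_semigroup_def)
qed (simp add: sgrp_eval_Cons)

lemma sgrp_eval_hom:
  assumes "w \<in> words A" "is_semigroup S" "f \<in> A \<rightarrow> scarrier S" "h \<in> sgrp_hom S T"
    "\<And>a. a \<in> A \<Longrightarrow> h (f a) = g a"
  shows "h (sgrp_eval S f w) = sgrp_eval T g w"
  using assms
proof (induction rule: words_induct)
  case (cons a w)
  have "sgrp_eval S f w \<in> scarrier S" "f a \<in> scarrier S"
    using cons by (auto intro: sgrp_eval_closed)
  then show ?case using cons by (auto simp: sgrp_eval_Cons sgrp_hom_def)
qed auto

lemma generated_membersD:
  assumes "pseudovariety V" "(S, f) \<in> generated_members V A"
  shows "S \<in> V" "is_semigroup S" "f \<in> A \<rightarrow> scarrier S" "f \<in> extensional A"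
    "sgrp_eval S f ` words A = scarrier S" "finite (scarrier S)"
proof -
  from assms(2) have *: "S \<in> V" "f \<in> A \<rightarrow>\<^sub>E scarrier S" "sgrp_eval S f ` words A = scarrier S"
    unfolding generated_members_def by blast+
  have "is_semigroup S \<and> finite (scarrier S)"
    using assms(1) *(1) unfolding pseudovariety_def by blast
  with * show "S \<in> V" "is_semigroup S" "f \<in> A \<rightarrow> scarrier S" "f \<in> extensional A"
    "sgrp_eval S f ` words A = scarrier S" "finite (scarrier S)"
    by (simp_all add: PiE_def)
qed

lemma free_pro_iff:
  "x \<in> topspace (free_pro V A) \<longleftrightarrow>
     x \<in> extensional (generated_members V A) \<and>
     (\<forall>S f. (S, f) \<in> generated_members V A \<longrightarrow> x (S, f) \<in> scarrier S) \<and>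
     (\<forall>S f T g h. (S, f) \<in> generated_members V A \<longrightarrow> (T, g) \<in> generated_members V A \<longrightarrow>
        h \<in> sgrp_hom S T \<longrightarrow> (\<forall>a\<in>A. h (f a) = g a) \<longrightarrow> h (x (S, f)) = x (T, g))"
proof -
  let ?G = "generated_members V A"
  have 1: "topspace (case i of (S, f) \<Rightarrow> discrete_topology (scarrier S)) = scarrier (fst i)"
    for i :: "nat sgrp \<times> ('a \<Rightarrow> nat)"
    by (cases i) simp
  have "x \<in> (\<Pi>\<^sub>E i\<in>?G. topspace (case i of (S, f) \<Rightarrow> discrete_topology (scarrier S))) \<longleftrightarrow>
      (\<forall>i\<in>?G. x i \<in> scarrier (fst i)) \<and> x \<in> extensional ?G"
    unfolding 1 by (rule PiE_iff)
  also have "\<dots> \<longleftrightarrow> x \<in> extensional ?G \<and> (\<forall>S f. (S, f) \<in> ?G \<longrightarrow> x (S, f) \<in> scarrier S)"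
    by (metis fst_conv surj_pair)
  finally have 2: "x \<in> topspace (product_topology
      (\<lambda>(S, f). discrete_topology (scarrier S)) ?G) \<longleftrightarrow> \<dots>"
    by (simp only: topspace_product_topology comp_def)
  show ?thesis
    unfolding free_pro_def topspace_subtopology Int_iff 2 mem_Collect_eq
    by (simp only: Ball_def split_paired_All prod.case) blast
qed

lemma free_proI:
  assumes "x \<in> extensional (generated_members V A)"
    and "\<And>S f. (S, f) \<in> generated_members V A \<Longrightarrow> x (S, f) \<in> scarrier S"
    and "\<And>S f T g h. \<lbrakk>(S, f) \<in> generated_members V A; (T, g) \<in> generated_members V A;
           h \<in> sgrp_hom S T; \<forall>a\<in>A. h (f a) = g a\<rbrakk> \<Longrightarrow> h (x (S, f)) = x (T, g)"
  shows "x \<in> topspace (free_pro V A)"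
  using assms unfolding free_pro_iff by blast

lemma free_proD:
  assumes "x \<in> topspace (free_pro V A)"
  shows "x \<in> extensional (generated_members V A)"
    and "(S, f) \<in> generated_members V A \<Longrightarrow> x (S, f) \<in> scarrier S"
    and "\<lbrakk>(S, f) \<in> generated_members V A; (T, g) \<in> generated_members V A;
           h \<in> sgrp_hom S T; \<forall>a\<in>A. h (f a) = g a\<rbrakk> \<Longrightarrow> h (x (S, f)) = x (T, g)"
  using assms unfolding free_pro_iff by blast+

lemma free_emb_apply:
  "(S, f) \<in> generated_members V A \<Longrightarrow> free_emb V A w (S, f) = sgrp_eval S f w"
  by (simp add: free_emb_def)

lemma free_emb_in:
  assumes V: "pseudovariety V" and w: "w \<in> words A"
  shows "free_emb V A w \<in> topspace (free_pro V A)"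
proof (rule free_proI)
  show "free_emb V A w \<in> extensional (generated_members V A)" by (simp add: free_emb_def)
next
  fix S f assume "(S, f) \<in> generated_members V A"
  then show "free_emb V A w (S, f) \<in> scarrier S"
    using generated_membersD[OF V] w sgrp_eval_closed by (metis free_emb_apply)
next
  fix S f T g h assume *: "(S, f) \<in> generated_members V A" "(T, g) \<in> generated_members V A"
    "h \<in> sgrp_hom S T" "\<forall>a\<in>A. h (f a) = g a"
  show "h (free_emb V A w (S, f)) = free_emb V A w (T, g)"
    unfolding free_emb_apply[OF *(1)] free_emb_apply[OF *(2)]
    using generated_membersD[OF V *(1)] *(3,4) w by (intro sgrp_eval_hom) blast+
qed

lemma Hausdorff_free_pro: "Hausdorff_space (free_pro V A)"
  unfolding free_pro_def
  by (intro Hausdorff_space_subtopology iffD2[OF Hausdorff_space_product_topology] disjI2 ballI)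
    (simp split: prod.split)

lemma generated_subsemigroup:
  assumes S: "is_semigroup S" and f: "f \<in> A \<rightarrow> scarrier S" and A: "A \<noteq> {}"
  defines "T \<equiv> S\<lparr>scarrier := sgrp_eval S f ` words A\<rparr>"
  shows "subsemigroup T S" "f \<in> A \<rightarrow> scarrier T"
    "w \<in> words A \<Longrightarrow> sgrp_eval T (restrict f A) w = sgrp_eval S f w"
proof -
  have *: "u @ v \<in> words A" if "u \<in> words A" "v \<in> words A" for u v
    using that by (auto simp: words_def)
  have "[a] \<in> words A" if "a \<in> A" for a using that by (simp add: words_def)
  note sing = this
  have ne: "words A \<noteq> {}" using A sing by blast
  have closed: "scarrier T \<subseteq> scarrier S"
    using sgrp_eval_closed[OF _ S f] by (auto simp: T_def)
  have "smult S x y \<in> scarrier T" if "x \<in> scarrier T" "y \<in> scarrier T" for x y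
  proof -
    from that obtain u v where uv: "u \<in> words A" "v \<in> words A" "x = sgrp_eval S f u" "y = sgrp_eval S f v"
      by (auto simp: T_def)
    show ?thesis
      using imageI[OF *[OF uv(1,2)], of "sgrp_eval S f"] uv(3,4) sgrp_eval_append[OF uv(1,2) S f]
      by (simp add: T_def)
  qed
  moreover have "smult T = smult S" by (simp add: T_def)
  moreover have "scarrier T \<noteq> {}" using ne by (simp add: T_def)
  ultimately show "subsemigroup T S"
    using S closed unfolding subsemigroup_def is_semigroup_def by (simp add: subset_iff)
  show "f \<in> A \<rightarrow> scarrier T"
  proof
    fix a assume "a \<in> A"
    from imageI[OF sing[OF this], of "sgrp_eval S f"] show "f a \<in> scarrier T" by (simp add: T_def)
  qed
  show "sgrp_eval T (restrict f A) w = sgrp_eval S f w" if "w \<in> words A"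
    using that by (induction rule: words_induct) (auto simp: sgrp_eval_Cons T_def)
qed

lemma generated_membersI:
  assumes V: "pseudovariety V" and S: "S \<in> V" and f: "f \<in> A \<rightarrow> scarrier S" and A: "A \<noteq> {}"
  shows "(S\<lparr>scarrier := sgrp_eval S f ` words A\<rparr>, restrict f A) \<in> generated_members V A"
proof -
  have sg: "is_semigroup S" using V S unfolding pseudovariety_def by blast
  note G = generated_subsemigroup[OF sg f A]
  have "S\<lparr>scarrier := sgrp_eval S f ` words A\<rparr> \<in> V"
    using V S G(1) unfolding pseudovariety_def by blast
  moreover have "restrict f A \<in> A \<rightarrow>\<^sub>E sgrp_eval S f ` words A"
    using G(2) by (simp add: PiE_def Pi_def)
  ultimately show ?thesis using G(3) by (simp add: generated_members_def)
qed

text \<open>Density of the free semigroup: finitely many generated members of \<open>V\<close> are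
  quotients of a single one.\<close>

lemma free_pro_finite_coords:
  assumes V: "pseudovariety V" and A: "A \<noteq> {}" and x: "x \<in> topspace (free_pro V A)"
    and J: "finite J" "J \<subseteq> generated_members V A"
  shows "\<exists>w\<in>words A. \<forall>(S, f)\<in>J. x (S, f) = sgrp_eval S f w"
proof -
  obtain e :: "nat \<Rightarrow> _" where e: "bij_betw e {0..<card J} J"
    using J(1) ex_bij_betw_nat_finite by blast
  define I where "I = {0..<card J}"
  define Q where "Q = (\<lambda>i. fst (e i))"
  define q where "q = (\<lambda>i. snd (e i))"
  define P where "P = sgrp_prod I Q"
  have eI: "(Q i, q i) \<in> generated_members V A" if "i \<in> I" for i
    using e J(2) that by (auto simp: Q_def q_def I_def bij_betw_def)
  note D = generated_membersD[OF V eI]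
  have carP: "scarrier P = (\<Pi>\<^sub>E i\<in>I. scarrier (Q i))" by (simp add: P_def sgrp_prod_def)
  have mulP: "smult P = (\<lambda>x y. \<lambda>i\<in>I. smult (Q i) (x i) (y i))" by (simp add: P_def sgrp_prod_def)
  have finP: "finite (scarrier P)"
    unfolding carP using D(6) by (intro finite_PiE) (auto simp: I_def)
  have sgP: "is_semigroup P"
    unfolding is_semigroup_def carP mulP
  proof (intro conjI ballI)
    show "(\<Pi>\<^sub>E i\<in>I. scarrier (Q i)) \<noteq> {}"
      using D(2) by (auto simp: PiE_eq_empty_iff is_semigroup_def)
  next
    fix a b assume "a \<in> (\<Pi>\<^sub>E i\<in>I. scarrier (Q i))" "b \<in> (\<Pi>\<^sub>E i\<in>I. scarrier (Q i))"
    then show "(\<lambda>i\<in>I. smult (Q i) (a i) (b i)) \<in> (\<Pi>\<^sub>E i\<in>I. scarrier (Q i))"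
      using D(2) by (auto simp: is_semigroup_def PiE_iff)
  next
    fix a b c assume "a \<in> (\<Pi>\<^sub>E i\<in>I. scarrier (Q i))" "b \<in> (\<Pi>\<^sub>E i\<in>I. scarrier (Q i))"
      "c \<in> (\<Pi>\<^sub>E i\<in>I. scarrier (Q i))"
    then show "(\<lambda>i\<in>I. smult (Q i) ((\<lambda>i\<in>I. smult (Q i) (a i) (b i)) i) (c i)) =
        (\<lambda>i\<in>I. smult (Q i) (a i) ((\<lambda>i\<in>I. smult (Q i) (b i) (c i)) i))"
      using D(2) by (intro ext) (auto simp: is_semigroup_def PiE_iff)
  qed
  obtain t where t: "bij_betw t (scarrier P) {0..<card (scarrier P)}"
    using ex_bij_betw_finite_nat[OF finP] by blast
  define t' where "t' = the_inv_into (scarrier P) t"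
  have t': "t' (t p) = p" if "p \<in> scarrier P" for p
    using t that by (auto simp: t'_def bij_betw_def the_inv_into_f_f)
  define T :: "nat sgrp" where
    "T = \<lparr>scarrier = t ` scarrier P, smult = (\<lambda>a b. t (smult P (t' a) (t' b)))\<rparr>"
  have sgT: "is_semigroup T"
    using sgP unfolding is_semigroup_def T_def by (simp add: t')
  have "t \<in> sgrp_hom P T"
    by (auto simp: sgrp_hom_def T_def t')
  moreover have "bij_betw t (scarrier P) (scarrier T)"
    using t by (simp add: T_def bij_betw_def)
  ultimately have "sgrp_iso P T" by (auto simp: sgrp_iso_def)
  moreover have "finite I" "\<forall>i\<in>I. Q i \<in> V"
    using D(1) by (auto simp: I_def)
  ultimately have TV: "T \<in> V"
    using V sgT unfolding pseudovariety_def P_def by blast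
  define f where "f = (\<lambda>a. t (\<lambda>i\<in>I. q i a))"
  have qP: "(\<lambda>i\<in>I. q i a) \<in> scarrier P" if "a \<in> A" for a
    using D(3) that by (auto simp: carP)
  have f: "f \<in> A \<rightarrow> scarrier T"
    using qP by (auto simp: f_def T_def)
  define U where "U = T\<lparr>scarrier := sgrp_eval T f ` words A\<rparr>"
  note G = generated_subsemigroup[OF sgT f A, folded U_def]
  have U: "(U, restrict f A) \<in> generated_members V A"
    unfolding U_def by (rule generated_membersI[OF V TV f A])
  have "x (U, restrict f A) \<in> scarrier U"
    using free_proD(2)[OF x U] .
  then obtain w where w: "w \<in> words A" "x (U, restrict f A) = sgrp_eval U (restrict f A) w"
    using generated_membersD(5)[OF V U] by (metis imageE)
  have "x (S, g) = sgrp_eval S g w" if "(S, g) \<in> J" for S g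
  proof -
    obtain i where i: "i \<in> I" "e i = (S, g)" using e \<open>(S, g) \<in> J\<close> unfolding bij_betw_def I_def by (metis imageE)
    define h where "h = (\<lambda>m. t' m i)"
    have Sg: "S = Q i" "g = q i" using i by (auto simp: Q_def q_def)
    have sub: "scarrier U \<subseteq> t ` scarrier P" using G(1) by (auto simp: subsemigroup_def T_def)
    have h: "h \<in> sgrp_hom U S"
      unfolding sgrp_hom_def
    proof (intro CollectI conjI ballI)
      show "h \<in> scarrier U \<rightarrow> scarrier S"
        using sub i(1) by (auto simp: h_def t' carP Sg dest!: subsetD)
      fix a b assume "a \<in> scarrier U" "b \<in> scarrier U"
      then obtain a' b' where ab: "a = t a'" "b = t b'" "a' \<in> scarrier P" "b' \<in> scarrier P"
        using sub by blast
      moreover from ab have "smult P a' b' \<in> scarrier P"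
        using sgP by (auto simp: is_semigroup_def)
      moreover have "smult U = smult T" by (simp add: U_def)
      ultimately show "h (smult U a b) = smult S (h a) (h b)"
        using i(1) by (simp add: h_def T_def t' Sg) (simp add: mulP)
    qed
    have hf: "h (restrict f A a) = g a" if "a \<in> A" for a
      using that qP i(1) by (simp add: h_def f_def t' Sg)
    have "x (S, g) = h (x (U, restrict f A))"
      using free_proD(3)[OF x U _ h] that J(2) hf by auto
    also have "\<dots> = sgrp_eval S g w"
      unfolding w(2)
      by (rule sgrp_eval_hom[OF w(1) generated_membersD(2,3)[OF V U] h hf])
    finally show ?thesis .
  qed
  with w(1) show ?thesis by blast
qed

lemma free_emb_dense:
  assumes V: "pseudovariety V" and A: "A \<noteq> {}"
  shows "free_pro V A closure_of (free_emb V A ` words A) = topspace (free_pro V A)"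
proof -
  have "\<exists>y\<in>free_emb V A ` words A. y \<in> N"
    if x: "x \<in> topspace (free_pro V A)" "x \<in> N" and N: "openin (free_pro V A) N" for x N
  proof -
    let ?I = "generated_members V A"
    let ?X = "\<lambda>(S, f :: 'a \<Rightarrow> nat). discrete_topology (scarrier (S :: nat sgrp))"
    obtain C where C: "openin (product_topology ?X ?I) C" "N = C \<inter> topspace (free_pro V A)"
    proof -
      obtain C Y where "openin (product_topology ?X ?I) C" "N = C \<inter> Y"
        "free_pro V A = subtopology (product_topology ?X ?I) Y"
        using N unfolding free_pro_def openin_subtopology by blast
      with openin_subset[OF this(1)] that show ?thesis
        by (simp only: topspace_subtopology) blast
    qed
    have "x \<in> C" using C x by blast
    then obtain W where W: "finite {i \<in> ?I. W i \<noteq> topspace (?X i)}"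
        "x \<in> Pi\<^sub>E ?I W" "Pi\<^sub>E ?I W \<subseteq> C"
      using C(1) unfolding openin_product_topology_alt by blast
    obtain w where w: "w \<in> words A"
      "\<forall>(S, f)\<in>{i \<in> ?I. W i \<noteq> topspace (?X i)}. x (S, f) = sgrp_eval S f w"
      using free_pro_finite_coords[OF V A x(1) W(1)] by auto
    have inF: "free_emb V A w \<in> topspace (free_pro V A)" by (rule free_emb_in[OF V w(1)])
    have "free_emb V A w i \<in> W i" if i: "i \<in> ?I" for i
    proof (cases "W i = topspace (?X i)")
      case True
      then show ?thesis using free_proD(2)[OF inF] i by (cases i) simp
    next
      case False
      then have "free_emb V A w i = x i"
        using w(2) i by (cases i) (auto simp: free_emb_apply)
      then show ?thesis using W(2) i by auto
    qed
    then have "free_emb V A w \<in> Pi\<^sub>E ?I W" by (auto simp: free_emb_def PiE_iff)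
    then show ?thesis using W(3) C(2) inF w(1) by blast
  qed
  then show ?thesis
    by (auto simp: closure_of_def)
qed

lemma pro_ext_unique_existence:
  assumes V: "pseudovariety V" and A: "A \<noteq> {}" and \<phi>: "word_hom A B \<phi>"
  shows "\<exists>!\<psi>. \<psi> \<in> cont_homs V A B \<and>
           (\<forall>w\<in>words A. \<psi> (free_emb V A w) = free_emb V B (\<phi> w))"
proof (rule ex_ex1I)
  define pull :: "nat sgrp \<times> ('b \<Rightarrow> nat) \<Rightarrow> nat sgrp \<times> ('a \<Rightarrow> nat)" where
    "pull = (\<lambda>(T, g). (T\<lparr>scarrier := sgrp_eval T (\<lambda>a. sgrp_eval T g (\<phi> [a])) ` words A\<rparr>,
                       \<lambda>a\<in>A. sgrp_eval T g (\<phi> [a])))"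
  define \<psi> :: "'a proelt \<Rightarrow> 'b proelt" where
    "\<psi> = (\<lambda>x\<in>topspace (free_pro V A). \<lambda>k\<in>generated_members V B. x (pull k))"
  have \<phi>w: "\<phi> w \<in> words B" if "w \<in> words A" for w
    using \<phi> that by (auto simp: word_hom_def)
  have sing: "[a] \<in> words A" if "a \<in> A" for a using that by (simp add: words_def)
  have gen: "(\<lambda>a. sgrp_eval T g (\<phi> [a])) \<in> A \<rightarrow> scarrier T"
    if "(T, g) \<in> generated_members V B" for T g
    using generated_membersD[OF V that] sing by (auto intro!: sgrp_eval_closed \<phi>w)
  have pull_in: "pull (T, g) \<in> generated_members V A" if "(T, g) \<in> generated_members V B" for T g
    unfolding pull_def using generated_membersI[OF V generated_membersD(1)[OF V that] gen[OF that] A]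
    by simp
  have pull_sub: "subsemigroup (fst (pull (T, g))) T" if "(T, g) \<in> generated_members V B" for T g
    unfolding pull_def
    using generated_subsemigroup(1)[OF generated_membersD(2)[OF V that] gen[OF that] A] by simp
  have pull_mult: "smult (fst (pull (T, g))) = smult T" for T g by (simp add: pull_def)
  have ev: "sgrp_eval T (\<lambda>a. sgrp_eval T g (\<phi> [a])) w = sgrp_eval T g (\<phi> w)"
    if Tg: "(T, g) \<in> generated_members V B" and w: "w \<in> words A" for T g w
    using w
  proof (induction rule: words_induct)
    case (cons a w)
    have "\<phi> (a # w) = \<phi> [a] @ \<phi> w"
      using \<phi> cons sing[OF cons(1)] unfolding word_hom_def by (metis append_Cons append_Nil)
    then show ?case
      using cons generated_membersD[OF V Tg] sing[OF cons(1)]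
      by (simp add: sgrp_eval_Cons sgrp_eval_append[OF \<phi>w \<phi>w])
  qed simp
  have evp: "sgrp_eval (fst (pull (T, g))) (snd (pull (T, g))) w = sgrp_eval T g (\<phi> w)"
    if Tg: "(T, g) \<in> generated_members V B" and w: "w \<in> words A" for T g w
    using generated_subsemigroup(3)[OF generated_membersD(2)[OF V Tg] gen[OF Tg] A w] ev[OF Tg w]
    by (simp add: pull_def)
  have xin: "x (pull (T, g)) \<in> scarrier (fst (pull (T, g)))"
    if "x \<in> topspace (free_pro V A)" "(T, g) \<in> generated_members V B" for x T g
    using free_proD(2)[OF that(1), of "fst (pull (T, g))" "snd (pull (T, g))"] pull_in[OF that(2)] by simp
  have in1: "\<psi> x \<in> topspace (free_pro V B)" if x: "x \<in> topspace (free_pro V A)" for x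
  proof -
    have "h (x (pull (S, f))) = x (pull (T, g))"
      if Sf: "(S, f) \<in> generated_members V B" and Tg: "(T, g) \<in> generated_members V B"
        and h: "h \<in> sgrp_hom S T" and hf: "\<forall>a\<in>B. h (f a) = g a" for S f T g h
    proof -
      note DS = generated_membersD[OF V Sf]
      have hev: "h (sgrp_eval S f (\<phi> w)) = sgrp_eval T g (\<phi> w)" if "w \<in> words A" for w
        using sgrp_eval_hom[OF \<phi>w[OF that] DS(2,3) h] hf by auto
      have "h \<in> sgrp_hom (fst (pull (S, f))) (fst (pull (T, g)))"
        unfolding sgrp_hom_def pull_mult
      proof (intro CollectI conjI ballI)
        show "h \<in> scarrier (fst (pull (S, f))) \<rightarrow> scarrier (fst (pull (T, g)))"
          using hev by (auto simp: pull_def ev[OF Sf] ev[OF Tg])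
        fix a b assume "a \<in> scarrier (fst (pull (S, f)))" "b \<in> scarrier (fst (pull (S, f)))"
        then show "h (smult S a b) = smult T (h a) (h b)"
          using h pull_sub[OF Sf] by (auto simp: sgrp_hom_def subsemigroup_def)
      qed
      moreover have "\<forall>a\<in>A. h (snd (pull (S, f)) a) = snd (pull (T, g)) a"
        using hev sing by (auto simp: pull_def)
      ultimately show ?thesis
        using free_proD(3)[OF x, of "fst (pull (S, f))" "snd (pull (S, f))"
          "fst (pull (T, g))" "snd (pull (T, g))" h] pull_in[OF Sf] pull_in[OF Tg] by simp
    qed
    moreover have "x (pull (T, g)) \<in> scarrier T" if "(T, g) \<in> generated_members V B" for T g
      using xin[OF x that] pull_sub[OF that] by (auto simp: subsemigroup_def)
    ultimately show ?thesis
      using x by (intro free_proI) (simp_all add: \<psi>_def)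
  qed
  have "\<psi> \<in> sgrp_hom (free_pro_sgrp V A) (free_pro_sgrp V B)"
    unfolding sgrp_hom_def
  proof (intro CollectI conjI ballI)
    show "\<psi> \<in> scarrier (free_pro_sgrp V A) \<rightarrow> scarrier (free_pro_sgrp V B)"
      using in1 by (auto simp: free_pro_sgrp_def)
    fix x y assume "x \<in> scarrier (free_pro_sgrp V A)" "y \<in> scarrier (free_pro_sgrp V A)"
    then have x: "x \<in> topspace (free_pro V A)" and y: "y \<in> topspace (free_pro V A)"
      by (auto simp: free_pro_sgrp_def)
    have xy: "smult (free_pro_sgrp V A) x y \<in> topspace (free_pro V A)"
    proof -
      have m: "x (S, f) \<in> scarrier S" "y (S, f) \<in> scarrier S" 
          if "(S, f) \<in> generated_members V A" for S f
        using free_proD(2)[OF x that] free_proD(2)[OF y that] .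
      have "smult S (x (S, f)) (y (S, f)) \<in> scarrier S" if "(S, f) \<in> generated_members V A" for S f
        using m[OF that] generated_membersD(2)[OF V that] by (auto simp: is_semigroup_def)
      moreover have "h (smult S (x (S, f)) (y (S, f))) = smult T (x (T, g)) (y (T, g))"
        if Sf: "(S, f) \<in> generated_members V A" and Tg: "(T, g) \<in> generated_members V A"
          and h: "h \<in> sgrp_hom S T" and hf: "\<forall>a\<in>A. h (f a) = g a" for S f T g h
      proof -
        have "h (x (S, f)) = x (T, g)" "h (y (S, f)) = y (T, g)"
          using free_proD(3)[OF x Sf Tg h hf] free_proD(3)[OF y Sf Tg h hf] .
        then show ?thesis using h m[OF Sf] by (auto simp: sgrp_hom_def)
      qed
      ultimately show ?thesis
        by (intro free_proI) (simp_all add: free_pro_sgrp_def)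
    qed
    have "smult (free_pro_sgrp V A) x y (pull (T, g)) = smult T (x (pull (T, g))) (y (pull (T, g)))"
      if "(T, g) \<in> generated_members V B" for T g
      using pull_in[OF that] pull_mult[of T g] by (auto simp: free_pro_sgrp_def split: prod.splits)
    then show "\<psi> (smult (free_pro_sgrp V A) x y) = smult (free_pro_sgrp V B) (\<psi> x) (\<psi> y)"
      using x y xy by (auto simp: \<psi>_def free_pro_sgrp_def intro!: restrict_ext)
  qed
  moreover have "continuous_map (free_pro V A) (free_pro V B) \<psi>"
  proof -
    have "continuous_map (free_pro V A) (discrete_topology (scarrier T)) (\<lambda>x. \<psi> x (T, g))"
      if Tg: "(T, g) \<in> generated_members V B" for T g
    proof -
      have "continuous_map (free_pro V A) (discrete_topology (scarrier (fst (pull (T, g)))))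
              (\<lambda>x. x (pull (T, g)))"
        unfolding free_pro_def
        using continuous_map_from_subtopology[OF continuous_map_product_projection[OF pull_in[OF Tg],
           of "\<lambda>(S, f). discrete_topology (scarrier S)"]]
        by (simp add: case_prod_unfold)
      then have "continuous_map (free_pro V A) (discrete_topology (scarrier T)) (\<lambda>x. x (pull (T, g)))"
        using pull_sub[OF Tg] continuous_map_into_fulltopology
          subtopology_discrete_topology[of "scarrier T" "scarrier (fst (pull (T, g)))"]
        unfolding subsemigroup_def by (metis inf.absorb2)
      then show ?thesis
        by (rule continuous_map_eq) (use Tg in \<open>simp add: \<psi>_def\<close>)
    qed
    then have "continuous_map (free_pro V A)
        (product_topology (\<lambda>(S, f). discrete_topology (scarrier S)) (generated_members V B)) \<psi>"
      by (auto simp: continuous_map_componentwise \<psi>_def)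
    moreover have "\<psi> ` topspace (free_pro V A) \<subseteq> topspace (free_pro V B)" using in1 by auto
    moreover obtain Y where Y: "free_pro V B = subtopology
        (product_topology (\<lambda>(S, f). discrete_topology (scarrier S)) (generated_members V B)) Y"
      unfolding free_pro_def by blast
    ultimately show ?thesis
      unfolding Y continuous_map_in_subtopology topspace_subtopology by blast
  qed
  moreover have "\<psi> (free_emb V A w) = free_emb V B (\<phi> w)" if w: "w \<in> words A" for w
  proof -
    have "free_emb V A w (pull (T, g)) = sgrp_eval T g (\<phi> w)"
      if "(T, g) \<in> generated_members V B" for T g
      using evp[OF that w] pull_in[OF that]
        free_emb_apply[of "fst (pull (T, g))" "snd (pull (T, g))" V A w] by simp
    then show ?thesis
      using free_emb_in[OF V w] by (auto simp: \<psi>_def free_emb_def[of V B] intro!: restrict_ext)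
  qed
  ultimately show "\<exists>\<psi>. \<psi> \<in> cont_homs V A B \<and>
           (\<forall>w\<in>words A. \<psi> (free_emb V A w) = free_emb V B (\<phi> w))"
    by (intro exI[of _ \<psi>]) (auto simp: cont_homs_def \<psi>_def)
next
  fix \<psi> \<psi>'
  assume 1: "\<psi> \<in> cont_homs V A B \<and> (\<forall>w\<in>words A. \<psi> (free_emb V A w) = free_emb V B (\<phi> w))"
    and 2: "\<psi>' \<in> cont_homs V A B \<and> (\<forall>w\<in>words A. \<psi>' (free_emb V A w) = free_emb V B (\<phi> w))"
  have "\<psi> x = \<psi>' x" if "x \<in> topspace (free_pro V A)" for x
  proof (rule forall_in_closure_of_eq[where Y = "free_pro V B" and f = \<psi> and g = \<psi>'])
    show "x \<in> free_pro V A closure_of (free_emb V A ` words A)"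
      using that free_emb_dense[OF V A] by simp
    show "continuous_map (free_pro V A) (free_pro V B) \<psi>"
      "continuous_map (free_pro V A) (free_pro V B) \<psi>'"
      using 1 2 by (auto simp: cont_homs_def)
    show "\<psi> y = \<psi>' y" if "y \<in> free_emb V A ` words A" for y
      using 1 2 that by auto
  qed (rule Hausdorff_free_pro)
  then show "\<psi> = \<psi>'"
    using 1 2 by (auto simp: cont_homs_def intro: extensionalityI)
qed


section \<open>Directive sequences\<close>

definition directive_sequence :: "(nat \<Rightarrow> 'a set) \<Rightarrow> (nat \<Rightarrow> 'a list \<Rightarrow> 'a list) \<Rightarrow> bool" where
  "directive_sequence A \<sigma> \<longleftrightarrow>
     (\<forall>n. finite (A n) \<and> A n \<noteq> {}) \<and> (\<forall>n. word_hom (A (Suc n)) (A n) (\<sigma> n))"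

definition bounded_alphabets :: "(nat \<Rightarrow> 'a set) \<Rightarrow> bool" where
  "bounded_alphabets A \<longleftrightarrow> finite (range A)"

definition dcomp :: "(nat \<Rightarrow> 'a list \<Rightarrow> 'a list) \<Rightarrow> nat \<Rightarrow> nat \<Rightarrow> 'a list \<Rightarrow> 'a list" where
  "dcomp \<sigma> n m = foldr (\<circ>) (map \<sigma> [n..<m]) id"

definition cluster_point :: "'a topology \<Rightarrow> (nat \<Rightarrow> 'a) \<Rightarrow> 'a \<Rightarrow> bool" where
  "cluster_point X s p \<longleftrightarrow> p \<in> topspace X \<and>
     (\<forall>U. openin X U \<and> p \<in> U \<longrightarrow> (\<exists>\<^sub>\<infinity>n. s n \<in> U))"

definition pro_image ::
    "nat sgrp set \<Rightarrow> (nat \<Rightarrow> 'a set) \<Rightarrow> (nat \<Rightarrow> 'a list \<Rightarrow> 'a list) \<Rightarrow> 'a proelt set" where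
  "pro_image V A \<sigma> =
     (\<Inter>n. pro_ext V (A n) (A 0) (dcomp \<sigma> 0 n) ` topspace (free_pro V (A n)))"

definition pro_Lambda ::
    "nat sgrp set \<Rightarrow> (nat \<Rightarrow> 'a set) \<Rightarrow> (nat \<Rightarrow> 'a list \<Rightarrow> 'a list) \<Rightarrow> 'a proelt set" where
  "pro_Lambda V A \<sigma> =
     {x. \<exists>w. (\<forall>n. w n \<in> (\<lambda>a. dcomp \<sigma> 0 n [a]) ` A n) \<and>
             cluster_point (free_pro V (A 0)) (\<lambda>n. free_emb V (A 0) (w n)) x}"

text \<open>The topology of pointwise convergence, and the coproduct of the spaces of continuous
  homomorphisms; the summand with index \<open>(A k, A l)\<close> consists of the homomorphisms from the
  free pro-\<open>V\<close> semigroup over \<open>A k\<close> to that over \<open>A l\<close>.\<close>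

definition hom_space :: "nat sgrp set \<Rightarrow> 'a set \<Rightarrow> 'b set \<Rightarrow> ('a proelt \<Rightarrow> 'b proelt) topology" where
  "hom_space V A B =
     subtopology (product_topology (\<lambda>_. free_pro V B) (topspace (free_pro V A))) (cont_homs V A B)"

definition hom_coproduct ::
    "nat sgrp set \<Rightarrow> (nat \<Rightarrow> 'a set) \<Rightarrow> (('a set \<times> 'a set) \<times> ('a proelt \<Rightarrow> 'a proelt)) topology" where
  "hom_coproduct V A =
     sum_topology (\<lambda>(C, D). hom_space V C D) (range A \<times> range A)"

definition compression ::
    "nat sgrp set \<Rightarrow> (nat \<Rightarrow> 'a set) \<Rightarrow> (nat \<Rightarrow> 'a list \<Rightarrow> 'a list) \<Rightarrow>
     'a set \<Rightarrow> ('a proelt \<Rightarrow> 'a proelt) \<Rightarrow> bool" where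
  "compression V A \<sigma> B \<xi> \<longleftrightarrow>
     cluster_point (hom_coproduct V A)
       (\<lambda>n. ((A n, A 0), pro_ext V (A n) (A 0) (dcomp \<sigma> 0 n)))
       ((B, A 0), \<xi>)"

end

theory Submission
  imports Defs
begin

text \<open>The image of a compression \<open>\<xi>\<close> is compact, hence closed, and each \<open>\<xi> x\<close> is a cluster point
  of values taken in the decreasing closed sets \<open>Im \<sigma>\<^sub>0\<^sub>,\<^sub>n\<close>, so it lies in all of them.
  Conversely, a basic neighbourhood of a point \<open>y\<close> of the \<open>V\<close>-image is determined by finitely many
  finite quotients. Since the alphabet \<open>B\<close> is finite, pointwise closeness at the letters provides
  an index \<open>n\<close> such that \<open>\<sigma>\<^sub>0\<^sub>,\<^sub>n\<close> and \<open>\<xi>\<close> agree on all of the free pro-\<open>V\<close> semigroup modulo these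
  quotients; so if \<open>y\<close> is the image of \<open>x\<close> under \<open>\<sigma>\<^sub>0\<^sub>,\<^sub>n\<close>, then \<open>\<xi> x\<close> is in the neighbourhood.\<close>

section \<open>Compactness of the free pro-V semigroup and closed images\<close>

lemma continuous_coord_product:
  assumes "(S, f) \<in> G"
  shows "continuous_map (product_topology (\<lambda>(S, f). discrete_topology (scarrier S)) G)
           (discrete_topology (scarrier S)) (\<lambda>x. x (S, f))"
  using continuous_map_product_projection[OF assms, of "\<lambda>(S, f). discrete_topology (scarrier S)"]
  by simp

lemma continuous_coord:
  assumes "(S, f) \<in> generated_members V A"
  shows "continuous_map (free_pro V A) (discrete_topology (scarrier S)) (\<lambda>x. x (S, f))"
  unfolding free_pro_def by (intro continuous_map_from_subtopology continuous_coord_product assms)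

text \<open>A product of finite discrete spaces is compact by Tychonoff, and each compatibility
  condition of the inverse limit is the equalizer of two continuous maps into a Hausdorff space, so
  the limit is a closed part of the product.\<close>

lemma compact_free_pro:
  assumes V: "pseudovariety V"
  shows "compact_space (free_pro V A)"
proof -
  define G where "G = generated_members V A"
  define P where "P = product_topology (\<lambda>(S :: nat sgrp, f :: 'a \<Rightarrow> nat).
    discrete_topology (scarrier S)) G"
  define Y where "Y = {x :: 'a proelt. \<forall>(S, f)\<in>G. \<forall>(T, g)\<in>G.
             \<forall>h\<in>sgrp_hom S T. (\<forall>a\<in>A. h (f a) = g a) \<longrightarrow> h (x (S, f)) = x (T, g)}"
  define I where "I = {((S, f), (T, g), h) | S f T g h. (S, f) \<in> G \<and> (T, g) \<in> G \<and>
    h \<in> sgrp_hom S T \<and> (\<forall>a\<in>A. h (f a) = g a)}"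
  define C where "C = (\<lambda>(i, j, h). {x \<in> topspace P. h (x i) = x j})"
  have "compact_space P"
    unfolding P_def compact_space_product_topology using generated_membersD(6)[OF V]
    by (auto simp: G_def compact_space_discrete_topology)
  have "closedin P (C k)" if "k \<in> I" for k
  proof -
    obtain S f T g h where k: "k = ((S, f), (T, g), h)" "(S, f) \<in> G" "(T, g) \<in> G"
      "h \<in> sgrp_hom S T" using \<open>k \<in> I\<close> by (auto simp: I_def)
    have "continuous_map P (discrete_topology (scarrier T)) (h \<circ> (\<lambda>x. x (S, f)))"
      unfolding P_def using k
      by (intro continuous_map_compose[OF continuous_coord_product]) (auto simp: sgrp_hom_def)
    then have "closedin P {x \<in> topspace P. (h \<circ> (\<lambda>x. x (S, f))) x = x (T, g)}"
      by (rule closedin_continuous_maps_eq[OF Hausdorff_space_discrete_topology _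
          continuous_coord_product[OF k(3), folded P_def]])
    then show ?thesis by (simp only: k(1) C_def prod.case comp_apply)
  qed
  \<comment> \<open>Inserting \<open>topspace P\<close> keeps the family nonempty and the
    intersection inside the space even if \<open>I\<close> is empty.\<close>
  then have "closedin P (\<Inter>(insert (topspace P) (C ` I)))"
    by (intro closedin_Inter) auto
  moreover have "x \<in> Y \<longleftrightarrow> (\<forall>(i, j, h)\<in>I. h (x i) = x j)" for x
  proof
    assume x: "x \<in> Y"
    show "\<forall>(i, j, h)\<in>I. h (x i) = x j"
    proof clarify
      fix S f T g h assume "((S, f), (T, g), h) \<in> I"
      then have "(S, f) \<in> G" "(T, g) \<in> G" "h \<in> sgrp_hom S T" "\<forall>a\<in>A. h (f a) = g a"
        by (simp_all add: I_def)
      with x show "h (x (S, f)) = x (T, g)" unfolding Y_def by blast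
    qed
  next
    assume x: "\<forall>(i, j, h)\<in>I. h (x i) = x j"
    have "h (x (S, f)) = x (T, g)"
      if "(S, f) \<in> G" "(T, g) \<in> G" "h \<in> sgrp_hom S T" "\<forall>a\<in>A. h (f a) = g a" for S f T g h
    proof -
      have "((S, f), (T, g), h) \<in> I" using that by (simp add: I_def)
      from bspec[OF x this] show ?thesis by simp
    qed
    then show "x \<in> Y" unfolding Y_def by blast
  qed
  then have "topspace P \<inter> Y = \<Inter>(insert (topspace P) (C ` I))"
    by (auto simp: C_def)
  ultimately have "compactin P (topspace P \<inter> Y)"
    using closedin_compact_space[OF \<open>compact_space P\<close>] by simp
  then have "compact_space (subtopology P Y)"
    by (metis compact_space_subtopology subtopology_restrict)
  then show ?thesis
    by (simp only: free_pro_def P_def Y_def G_def)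
qed

lemma closedin_cont_hom_image:
  assumes V: "pseudovariety V" and \<psi>: "\<psi> \<in> cont_homs V A B"
  shows "closedin (free_pro V B) (\<psi> ` topspace (free_pro V A))"
  using \<psi> compact_free_pro[OF V, of A] unfolding cont_homs_def compact_space_def
  by (blast intro: compactin_imp_closedin[OF Hausdorff_free_pro] image_compactin)

section \<open>Continuous homomorphisms and neighbourhoods in finitely many coordinates\<close>

lemma cont_hom_mult:
  assumes "\<psi> \<in> cont_homs V A B" "x \<in> topspace (free_pro V A)" "y \<in> topspace (free_pro V A)"
  shows "\<psi> (smult (free_pro_sgrp V A) x y) = smult (free_pro_sgrp V B) (\<psi> x) (\<psi> y)"
  using assms by (simp add: cont_homs_def sgrp_hom_def free_pro_sgrp_def)

lemma free_emb_Cons: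
  assumes "w \<in> words A"
  shows "free_emb V A (a # w) = smult (free_pro_sgrp V A) (free_emb V A [a]) (free_emb V A w)"
  using assms by (auto simp: free_emb_def free_pro_sgrp_def sgrp_eval_Cons)

text \<open>Multiplication is coordinatewise, so agreement at the letters passes to words by
  induction, and then to the closure of the words because the coordinate is continuous into a
  discrete space. This turns conditions at the letters into agreement that is uniform in
  \<open>x\<close>.\<close>

lemma cont_homs_coord_eq:
  assumes V: "pseudovariety V" and A: "A \<noteq> {}"
    and \<phi>: "\<phi> \<in> cont_homs V A B" and \<psi>: "\<psi> \<in> cont_homs V A B"
    and Sf: "(S, f) \<in> generated_members V B"
    and eq: "\<And>a. a \<in> A \<Longrightarrow> \<phi> (free_emb V A [a]) (S, f) = \<psi> (free_emb V A [a]) (S, f)"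
    and x: "x \<in> topspace (free_pro V A)"
  shows "\<phi> x (S, f) = \<psi> x (S, f)"
proof -
  have cont: "continuous_map (free_pro V A) (discrete_topology (scarrier S)) (\<lambda>x. \<theta> x (S, f))"
    if "\<theta> \<in> cont_homs V A B" for \<theta>
    using continuous_map_compose[OF _ continuous_coord[OF Sf], of "free_pro V A" \<theta>] that
    by (simp add: cont_homs_def comp_def)
  have "\<phi> (free_emb V A w) (S, f) = \<psi> (free_emb V A w) (S, f)" if "w \<in> words A" for w
    using that
  proof (induction rule: words_induct)
    case (cons a w)
    have mem: "free_emb V A [a] \<in> topspace (free_pro V A)" "free_emb V A w \<in> topspace (free_pro V A)"
      using cons by (auto intro!: free_emb_in[OF V] simp: words_def)
    have step: "\<theta> (free_emb V A (a # w)) (S, f) =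
        smult S (\<theta> (free_emb V A [a]) (S, f)) (\<theta> (free_emb V A w) (S, f))"
      if "\<theta> \<in> cont_homs V A B" for \<theta>
      unfolding free_emb_Cons[OF cons(2)] cont_hom_mult[OF that mem]
      using Sf by (simp add: free_pro_sgrp_def)
    show ?case by (simp only: step[OF \<phi>] step[OF \<psi>] cons.IH eq[OF cons(1)])
  qed (rule eq)
  moreover have "x \<in> free_pro V A closure_of (free_emb V A ` words A)"
    using x free_emb_dense[OF V A] by simp
  ultimately show ?thesis
    by (intro forall_in_closure_of_eq[OF _ _ cont[OF \<phi>] cont[OF \<psi>], of x "free_emb V A ` words A"])
      auto
qed

text \<open>A basic open box of the product restricts only finitely many coordinates;
  \<open>J\<close> collects these.\<close>

lemma free_pro_basic_nbhd:
  assumes N: "openin (free_pro V A) N" and y: "y \<in> N"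
  shows "\<exists>J. finite J \<and> J \<subseteq> generated_members V A \<and>
           (\<forall>z\<in>topspace (free_pro V A). (\<forall>i\<in>J. z i = y i) \<longrightarrow> z \<in> N)"
proof -
  let ?G = "generated_members V A"
  let ?X = "\<lambda>(S, f :: 'a \<Rightarrow> nat). discrete_topology (scarrier (S :: nat sgrp))"
  obtain C Y where C: "openin (product_topology ?X ?G) C" "N = C \<inter> Y"
    "free_pro V A = subtopology (product_topology ?X ?G) Y"
    using N unfolding free_pro_def openin_subtopology by blast
  obtain W where W: "finite {i \<in> ?G. W i \<noteq> topspace (?X i)}" "y \<in> Pi\<^sub>E ?G W" "Pi\<^sub>E ?G W \<subseteq> C"
    using C(1,2) y unfolding openin_product_topology_alt by blast
  have "z \<in> N" if z: "z \<in> topspace (free_pro V A)"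
    and eq: "\<forall>i\<in>{i \<in> ?G. W i \<noteq> topspace (?X i)}. z i = y i" for z
  proof -
    have zP: "z \<in> topspace (product_topology ?X ?G)" and zY: "z \<in> Y"
      using z unfolding C(3) topspace_subtopology by blast+
    have "z i \<in> W i" if "i \<in> ?G" for i
    proof (cases "W i = topspace (?X i)")
      case True
      then show ?thesis using PiE_mem[OF zP[unfolded topspace_product_topology] that] by (simp only: comp_apply)
    next
      case False
      then have "z i = y i" using eq that by blast
      then show ?thesis using PiE_mem[OF W(2) that] by simp
    qed
    then have "z \<in> Pi\<^sub>E ?G W"
      using zP unfolding topspace_product_topology by (simp add: PiE_iff)
    then show ?thesis using W(3) C(2) zY by blast
  qed
  then show ?thesis using W(1) by (intro exI[of _ "{i \<in> ?G. W i \<noteq> topspace (?X i)}"]) auto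
qed

section \<open>Extensions of the compositions along a directive sequence\<close>

lemma pro_ext_props:
  assumes "pseudovariety V" "A \<noteq> {}" "word_hom A B \<phi>"
  shows "pro_ext V A B \<phi> \<in> cont_homs V A B"
    and "w \<in> words A \<Longrightarrow> pro_ext V A B \<phi> (free_emb V A w) = free_emb V B (\<phi> w)"
  using theI'[OF pro_ext_unique_existence[OF assms]] unfolding pro_ext_def by auto

text \<open>Serves to split \<open>dcomp\<close>: in a \<open>foldr\<close> over a concatenated
  list, the second part becomes the initial value of the first.\<close>

lemma foldr_comp: "foldr (\<circ>) fs g = foldr (\<circ>) fs id \<circ> g"
  by (induction fs) (auto simp: comp_assoc)

lemma dcomp_split:
  assumes "k \<le> m" "m \<le> n"
  shows "dcomp \<sigma> k n = dcomp \<sigma> k m \<circ> dcomp \<sigma> m n"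
proof -
  have "[k..<n] = [k..<m] @ [m..<n]" using assms by (metis le_Suc_ex upt_add_eq_append)
  then show ?thesis unfolding dcomp_def by (simp add: foldr_comp[of _ "foldr _ _ _"])
qed

lemma word_hom_dcomp:
  assumes "directive_sequence A \<sigma>" "m \<le> n"
  shows "word_hom (A n) (A m) (dcomp \<sigma> m n)"
  using assms(2)
proof (induction rule: dec_induct)
  case base
  then show ?case by (simp add: dcomp_def word_hom_def)
next
  case (step n)
  have "dcomp \<sigma> m (Suc n) = dcomp \<sigma> m n \<circ> \<sigma> n"
    using step by (simp add: dcomp_split[of m n "Suc n"]) (simp add: dcomp_def)
  moreover have "word_hom (A (Suc n)) (A n) (\<sigma> n)"
    using assms(1) by (simp add: directive_sequence_def)
  ultimately show ?case using step.IH unfolding word_hom_def by (auto simp: Pi_iff)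
qed

text \<open>On words this is the factorization of \<open>dcomp\<close> through level
  \<open>m\<close>. Density of the words and closedness of the image at level \<open>m\<close>
  extend it to all points, without a composition law for \<open>pro_ext\<close>.\<close>

lemma pro_ext_dcomp_image_antimono:
  assumes V: "pseudovariety V" and \<sigma>: "directive_sequence A \<sigma>" and mn: "m \<le> n"
    and x: "x \<in> topspace (free_pro V (A n))"
  shows "pro_ext V (A n) (A 0) (dcomp \<sigma> 0 n) x \<in>
           pro_ext V (A m) (A 0) (dcomp \<sigma> 0 m) ` topspace (free_pro V (A m))" (is "?f x \<in> ?K")
proof -
  have ne: "A k \<noteq> {}" for k using \<sigma> by (simp add: directive_sequence_def)
  note ext = pro_ext_props[OF V ne word_hom_dcomp[OF \<sigma> le0]]
  have "?f (free_emb V (A n) w) \<in> ?K" if w: "w \<in> words (A n)" for w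
  proof -
    have v: "dcomp \<sigma> m n w \<in> words (A m)"
      using word_hom_dcomp[OF \<sigma> mn] w by (auto simp: word_hom_def)
    have "dcomp \<sigma> 0 n w = dcomp \<sigma> 0 m (dcomp \<sigma> m n w)"
      using dcomp_split[OF le0 mn, of \<sigma>] by simp
    then have "?f (free_emb V (A n) w) =
        pro_ext V (A m) (A 0) (dcomp \<sigma> 0 m) (free_emb V (A m) (dcomp \<sigma> m n w))"
      by (simp only: ext(2)[OF v] ext(2)[OF w])
    then show ?thesis using free_emb_in[OF V v] by blast
  qed
  then have "?f ` free_emb V (A n) ` words (A n) \<subseteq> ?K" by blast
  moreover have "?f ` (free_pro V (A n) closure_of (free_emb V (A n) ` words (A n)))
      \<subseteq> free_pro V (A 0) closure_of (?f ` free_emb V (A n) ` words (A n))"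
    using ext(1)[of n] by (intro continuous_map_image_closure_subset) (simp add: cont_homs_def)
  moreover have "closedin (free_pro V (A 0)) ?K"
    by (rule closedin_cont_hom_image[OF V ext(1)])
  ultimately have "?f ` topspace (free_pro V (A n)) \<subseteq> ?K"
    unfolding free_emb_dense[OF V ne] by (meson closure_of_minimal order_trans)
  then show ?thesis using imageI[OF x] by (rule subsetD)
qed

section \<open>Pointwise convergence and neighbourhoods of a compression\<close>

lemma topspace_hom_space: "topspace (hom_space V A B) = cont_homs V A B"
proof -
  have "\<psi> \<in> (\<Pi>\<^sub>E x\<in>topspace (free_pro V A). topspace (free_pro V B))" if "\<psi> \<in> cont_homs V A B" for \<psi>
    using that by (simp add: cont_homs_def sgrp_hom_def free_pro_sgrp_def PiE_def)
  then show ?thesis by (auto simp: hom_space_def)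
qed

lemma openin_hom_space_eval:
  assumes "x \<in> topspace (free_pro V A)" "openin (free_pro V B) N"
  shows "openin (hom_space V A B) {\<psi> \<in> cont_homs V A B. \<psi> x \<in> N}"
proof -
  have "continuous_map (hom_space V A B) (free_pro V B) (\<lambda>\<psi>. \<psi> x)"
    unfolding hom_space_def
    by (intro continuous_map_from_subtopology continuous_map_product_projection assms)
  from openin_continuous_map_preimage[OF this assms(2)] show ?thesis
    by (simp add: topspace_hom_space)
qed

text \<open>The inclusion of a summand into a coproduct is an open map, so a neighbourhood of \<xi>
  in its summand is one in the coproduct. Visits to it carry the tag \<open>(B, A 0)\<close>, which
  forces \<open>A n = B\<close>.\<close>

lemma compressionD:
  assumes "compression V A \<sigma> B \<xi>"
  shows "B \<in> range A" "\<xi> \<in> cont_homs V B (A 0)"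
    and "\<lbrakk>openin (hom_space V B (A 0)) U; \<xi> \<in> U\<rbrakk> \<Longrightarrow>
      \<exists>\<^sub>\<infinity>n. A n = B \<and> pro_ext V (A n) (A 0) (dcomp \<sigma> 0 n) \<in> U"
proof -
  have "((B, A 0), \<xi>) \<in> topspace (hom_coproduct V A)"
    using assms by (simp add: compression_def cluster_point_def)
  then show 1: "B \<in> range A" and "\<xi> \<in> cont_homs V B (A 0)"
    by (auto simp: hom_coproduct_def topspace_hom_space)
  assume U: "openin (hom_space V B (A 0)) U" "\<xi> \<in> U"
  have "openin (hom_coproduct V A) (Pair (B, A 0) ` U)"
    using open_map_component_injection[of "(B, A 0)" "range A \<times> range A"
        "\<lambda>(C, D). hom_space V C D"] 1 U(1)
    by (auto simp: hom_coproduct_def open_map_def)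
  then have "\<exists>\<^sub>\<infinity>n. ((A n, A 0), pro_ext V (A n) (A 0) (dcomp \<sigma> 0 n)) \<in> Pair (B, A 0) ` U"
    using assms U(2) unfolding compression_def cluster_point_def by blast
  then show "\<exists>\<^sub>\<infinity>n. A n = B \<and> pro_ext V (A n) (A 0) (dcomp \<sigma> 0 n) \<in> U"
    by (rule INFM_mono) auto
qed

lemma compression_frequently_at:
  assumes "compression V A \<sigma> B \<xi>" "x \<in> topspace (free_pro V B)"
    and "openin (free_pro V (A 0)) N" "\<xi> x \<in> N"
  shows "\<exists>\<^sub>\<infinity>n. A n = B \<and> pro_ext V (A n) (A 0) (dcomp \<sigma> 0 n) x \<in> N"
  using compressionD(3)[OF assms(1) openin_hom_space_eval[OF assms(2,3)]]
    compressionD(2)[OF assms(1)] assms(4) by (auto elim: INFM_mono)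

section \<open>The two inclusions between the images, and the values at letters\<close>

lemma compression_image_subset:
  assumes V: "pseudovariety V" and \<sigma>: "directive_sequence A \<sigma>"
    and \<xi>: "compression V A \<sigma> B \<xi>" and x: "x \<in> topspace (free_pro V B)"
  shows "\<xi> x \<in> pro_image V A \<sigma>"
  unfolding pro_image_def
proof
  fix m
  let ?\<psi> = "\<lambda>n. pro_ext V (A n) (A 0) (dcomp \<sigma> 0 n)"
  let ?K = "?\<psi> m ` topspace (free_pro V (A m))"
  have ne: "A k \<noteq> {}" for k using \<sigma> by (simp add: directive_sequence_def)
  have cl: "closedin (free_pro V (A 0)) ?K"
    by (intro closedin_cont_hom_image[OF V] pro_ext_props(1) V ne word_hom_dcomp \<sigma>) simp
  show "\<xi> x \<in> ?K"
  proof (rule ccontr)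
    assume "\<xi> x \<notin> ?K"
    moreover have "\<xi> x \<in> topspace (free_pro V (A 0))"
      using compressionD(2)[OF \<xi>] x by (auto simp: cont_homs_def sgrp_hom_def free_pro_sgrp_def)
    \<comment> \<open>The complement of the closed set \<open>?K\<close> is a neighbourhood of
      \<open>\<xi> x\<close>. Infinitely many visits provide one beyond \<open>m\<close>, where the
      images are already contained in \<open>?K\<close>.\<close>
    ultimately have "\<exists>\<^sub>\<infinity>n. A n = B \<and> ?\<psi> n x \<in> topspace (free_pro V (A 0)) - ?K"
      using cl by (intro compression_frequently_at[OF \<xi> x]) auto
    then obtain n where "m < n" "A n = B" "?\<psi> n x \<notin> ?K"
      unfolding INFM_nat by blast
    then show False
      using pro_ext_dcomp_image_antimono[OF V \<sigma>, of m n x] x by simp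
  qed
qed

lemma pro_image_subset_compression_image:
  assumes V: "pseudovariety V" and \<sigma>: "directive_sequence A \<sigma>"
    and \<xi>: "compression V A \<sigma> B \<xi>" and y: "y \<in> pro_image V A \<sigma>"
  shows "y \<in> \<xi> ` topspace (free_pro V B)"
proof -
  let ?\<psi> = "\<lambda>n. pro_ext V (A n) (A 0) (dcomp \<sigma> 0 n)"
  have ne: "A k \<noteq> {}" for k using \<sigma> by (simp add: directive_sequence_def)
  have B: "finite B" "B \<noteq> {}"
    using \<sigma> compressionD(1)[OF \<xi>] by (auto simp: directive_sequence_def)
  have hom: "?\<psi> n \<in> cont_homs V (A n) (A 0)" for n
    by (intro pro_ext_props(1) V ne word_hom_dcomp \<sigma>) simp
  note \<xi>hom = compressionD(2)[OF \<xi>]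
  have \<xi>in: "\<xi> x \<in> topspace (free_pro V (A 0))" if "x \<in> topspace (free_pro V B)" for x
    using \<xi>hom that by (auto simp: cont_homs_def sgrp_hom_def free_pro_sgrp_def)
  have "\<exists>z\<in>\<xi> ` topspace (free_pro V B). z \<in> N"
    if N: "openin (free_pro V (A 0)) N" "y \<in> N" for N
  proof -
    obtain J where J: "finite J" "J \<subseteq> generated_members V (A 0)"
      "\<And>z. z \<in> topspace (free_pro V (A 0)) \<Longrightarrow> (\<And>i. i \<in> J \<Longrightarrow> z i = y i) \<Longrightarrow> z \<in> N"
      using free_pro_basic_nbhd[OF N] by metis
    \<comment> \<open>One condition for each letter \<open>b\<close> and coordinate
      \<open>i\<close>: agreement with \<xi> there. Each is open because the coordinates are
      discrete, and there are finitely many because \<open>B\<close> and \<open>J\<close> are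
      finite.\<close>
    define E where "E = (\<lambda>(b, i). {\<psi> \<in> cont_homs V B (A 0).
      \<psi> (free_emb V B [b]) i = \<xi> (free_emb V B [b]) i})"
    have bin: "free_emb V B [b] \<in> topspace (free_pro V B)" if "b \<in> B" for b
      using that by (intro free_emb_in V) (simp add: words_def)
    have "openin (hom_space V B (A 0)) (E k)" if "k \<in> B \<times> J" for k
    proof -
      obtain b S f where k: "k = (b, S, f)" "b \<in> B" "(S, f) \<in> generated_members V (A 0)"
        using \<open>k \<in> B \<times> J\<close> J(2) by (cases k) auto
      let ?c = "\<xi> (free_emb V B [b]) (S, f)"
      have "?c \<in> scarrier S" using free_proD(2)[OF \<xi>in[OF bin[OF k(2)]] k(3)] .
      then have "openin (free_pro V (A 0)) {z \<in> topspace (free_pro V (A 0)). z (S, f) \<in> {?c}}"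
        by (intro openin_continuous_map_preimage[OF continuous_coord[OF k(3)]]) simp
      from openin_hom_space_eval[OF bin[OF k(2)] this]
      have "openin (hom_space V B (A 0)) {\<psi> \<in> cont_homs V B (A 0).
          \<psi> (free_emb V B [b]) \<in> {z \<in> topspace (free_pro V (A 0)). z (S, f) \<in> {?c}}}" .
      moreover have "\<psi> (free_emb V B [b]) \<in> topspace (free_pro V (A 0))"
        if "\<psi> \<in> cont_homs V B (A 0)" for \<psi>
        using that bin[OF k(2)] by (auto simp: cont_homs_def sgrp_hom_def free_pro_sgrp_def)
      ultimately show ?thesis by (auto simp: E_def k(1) elim!: back_subst[of "openin _"])
    qed
    \<comment> \<open>If \<open>J\<close> is empty, the intersection over
      \<open>B \<times> J\<close> is the universal set, so the space itself has to be intersected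
      in.\<close>
    then have "openin (hom_space V B (A 0))
        (topspace (hom_space V B (A 0)) \<inter> \<Inter>(E ` (B \<times> J)))"
      using B(1) J(1) by (intro openin_Int_Inter) auto
    moreover have "\<xi> \<in> topspace (hom_space V B (A 0)) \<inter> \<Inter>(E ` (B \<times> J))"
      using \<xi>hom by (auto simp: E_def topspace_hom_space)
    ultimately obtain n where n: "A n = B" "?\<psi> n \<in> \<Inter>(E ` (B \<times> J))"
      using compressionD(3)[OF \<xi>] INFM_EX by blast
    \<comment> \<open>The preimage \<open>x\<close> depends on \<open>n\<close>, hence on
      \<open>N\<close>; the argument therefore places \<open>y\<close> only in the closure of the
      image of \<xi>, which is closed.\<close>
    obtain x where x: "x \<in> topspace (free_pro V B)" "y = ?\<psi> n x"
      using y n(1) unfolding pro_image_def by blast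
    have "\<xi> x i = y i" if "i \<in> J" for i
    proof -
      obtain S f where i: "i = (S, f)" by (cases i)
      show ?thesis
        unfolding i x(2)
      proof (rule cont_homs_coord_eq[OF V B(2) \<xi>hom _ _ _ x(1)])
        show "?\<psi> n \<in> cont_homs V B (A 0)" using hom[of n] n(1) by simp
        show "(S, f) \<in> generated_members V (A 0)" using that i J(2) by blast
        fix b assume "b \<in> B"
        then show "\<xi> (free_emb V B [b]) (S, f) = ?\<psi> n (free_emb V B [b]) (S, f)"
          using n(2) that i by (auto simp: E_def)
      qed
    qed
    then have "\<xi> x \<in> N" by (rule J(3)[OF \<xi>in[OF x(1)]])
    then show ?thesis using x(1) by blast
  qed
  moreover have "y \<in> topspace (free_pro V (A 0))"
    using y hom[of 0] unfolding pro_image_def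
    by (auto simp: cont_homs_def sgrp_hom_def free_pro_sgrp_def)
  ultimately have "y \<in> free_pro V (A 0) closure_of (\<xi> ` topspace (free_pro V B))"
    by (auto simp: in_closure_of)
  then show ?thesis
    using closure_of_closedin[OF closedin_cont_hom_image[OF V \<xi>hom]] by simp
qed

text \<open>Where \<open>A n = B\<close>, the extended map sends the letter \<open>b\<close> to the
  embedded word \<open>dcomp \<sigma> 0 n [b]\<close>, and \<xi> is approached at \<open>b\<close>
  along infinitely many such \<open>n\<close>.\<close>

lemma compression_letter_in_pro_Lambda:
  assumes V: "pseudovariety V" and \<sigma>: "directive_sequence A \<sigma>"
    and \<xi>: "compression V A \<sigma> B \<xi>" and b: "b \<in> B"
  shows "\<xi> (free_emb V B [b]) \<in> pro_Lambda V A \<sigma>"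
proof -
  have ne: "A k \<noteq> {}" for k using \<sigma> by (simp add: directive_sequence_def)
  \<comment> \<open>At the other indices any letter will do, since a cluster point only requires
    infinitely many good indices.\<close>
  define c where "c = (\<lambda>n. if A n = B then b else (SOME a. a \<in> A n))"
  define w where "w = (\<lambda>n. dcomp \<sigma> 0 n [c n])"
  have "c n \<in> A n" for n using b ne[of n] by (auto simp: c_def some_in_eq)
  then have "w n \<in> (\<lambda>a. dcomp \<sigma> 0 n [a]) ` A n" for n by (auto simp: w_def)
  moreover have "cluster_point (free_pro V (A 0)) (\<lambda>n. free_emb V (A 0) (w n)) (\<xi> (free_emb V B [b]))"
    unfolding cluster_point_def
  proof (intro conjI allI impI)
    have bw: "[b] \<in> words B" using b by (simp add: words_def)
    note bin = free_emb_in[OF V bw]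
    show "\<xi> (free_emb V B [b]) \<in> topspace (free_pro V (A 0))"
      using compressionD(2)[OF \<xi>] bin by (auto simp: cont_homs_def sgrp_hom_def free_pro_sgrp_def)
    fix N assume N: "openin (free_pro V (A 0)) N \<and> \<xi> (free_emb V B [b]) \<in> N"
    have eq: "pro_ext V (A n) (A 0) (dcomp \<sigma> 0 n) (free_emb V B [b]) = free_emb V (A 0) (w n)"
      if "A n = B" for n
      using pro_ext_props(2)[OF V ne word_hom_dcomp[OF \<sigma> le0], of "[b]" n] bw that
      by (simp add: w_def c_def)
    have "\<exists>\<^sub>\<infinity>n. A n = B \<and> pro_ext V (A n) (A 0) (dcomp \<sigma> 0 n) (free_emb V B [b]) \<in> N"
      using compression_frequently_at[OF \<xi> bin] N by blast
    then show "\<exists>\<^sub>\<infinity>n. free_emb V (A 0) (w n) \<in> N"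
      by (rule INFM_mono) (metis eq)
  qed
  ultimately show ?thesis unfolding pro_Lambda_def by blast
qed

theorem theorem8p5:
  fixes V :: "nat sgrp set"
    and A :: "nat \<Rightarrow> 'a set"
    and \<sigma> :: "nat \<Rightarrow> 'a list \<Rightarrow> 'a list"
    and B :: "'a set"
    and \<xi> :: "'a proelt \<Rightarrow> 'a proelt"
  assumes "pseudovariety V"
    and "pv_N \<subseteq> V"
    and "directive_sequence A \<sigma>"
    and "bounded_alphabets A"
    and "compression V A \<sigma> B \<xi>"
  shows "\<xi> ` topspace (free_pro V B) = pro_image V A \<sigma> \<and>
         (\<lambda>b. \<xi> (free_emb V B [b])) ` B \<subseteq> pro_Lambda V A \<sigma>"
  using compression_image_subset[OF assms(1,3,5)] pro_image_subset_compression_image[OF assms(1,3,5)]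
    compression_letter_in_pro_Lambda[OF assms(1,3,5)] by blast

end
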